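(* Let $K>0$ and $\theta\in(-\pi/4,\pi/4]$ with $Ke^{i\theta}\in U$, and for $c\in\mathbb{C}$ let $f_c=g_c\circ h_{K,\theta}$, where $g_c(z)=z^2+c$. Let $L_1=\min\{K,1\}$. Then $$\mathcal{M}_{K,\theta}\subset\{c\in\mathbb{C}:|c|\le 2L_1^{-2}\}.$$ Further, $\mathcal{M}_{K,\theta}$ is compact and can be characterised as the set of $c\in\mathbb{C}$ for which $|f_c^{n}(0)|\le 2L_1^{-2}$ for all $n\in\mathbb{N}$.
   Context: For $K>0$ and $\theta\in\mathbb{R}$, $h_{K,\theta}:\mathbb{C}\to\mathbb{C}$ is the affine stretch $h_{K,\theta}(z)=\left(\frac{K+1}{2}\right)z+e^{2i\theta}\left(\frac{K-1}{2}\right)\overline{z}$. The set $U$ is $$U=\{0<|z|<1,\ -\pi/4<\arg(z)\le \pi/4\}\cup\{|z|>1,\ -\pi/4<\arg(z)\le\pi/4\}\cup\{1\}\subset\mathbb{C}.$$ The escaping set of $f:\mathbb{C}\to\mathbb{C}$ is $I(f)=\{z\in\mathbb{C}: f^{n}(z)\to\infty\}$, where $f^n$ is the $n$-th iterate. The $(K,\theta)$-Mandelbrot set $\mathcal{M}_{K,\theta}$ is the set of those $c\in\mathbb{C}$ for which $0\notin I(f_c)$. *)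

theory Defs
  imports "HOL-Analysis.Analysis"
begin

definition stretch :: "real \<Rightarrow> real \<Rightarrow> complex \<Rightarrow> complex" where
  "stretch K \<theta> z = of_real ((K + 1) / 2) * z
     + exp (2 * \<i> * of_real \<theta>) * of_real ((K - 1) / 2) * cnj z"

text \<open>Since \<open>Arg\<close> is the principal argument in \<open>(-pi, pi]\<close>, the condition below is the one on arg.
  The unit circle meets the region only in 1.\<close>

definition param_region :: "complex set" where
  "param_region =
     {z. 0 < cmod z \<and> cmod z < 1 \<and> - pi / 4 < Arg z \<and> Arg z \<le> pi / 4}
     \<union> {z. cmod z > 1 \<and> - pi / 4 < Arg z \<and> Arg z \<le> pi / 4}
     \<union> {1}"

definition quad_map :: "complex \<Rightarrow> complex \<Rightarrow> complex" where
  "quad_map c z = z\<^sup>2 + c"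

definition stretch_quad :: "real \<Rightarrow> real \<Rightarrow> complex \<Rightarrow> complex \<Rightarrow> complex" where
  "stretch_quad K \<theta> c = quad_map c \<circ> stretch K \<theta>"

definition escaping_set :: "(complex \<Rightarrow> complex) \<Rightarrow> complex set" where
  "escaping_set f = {z. filterlim (\<lambda>n. (f ^^ n) z) at_infinity sequentially}"

definition mandelbrot :: "real \<Rightarrow> real \<Rightarrow> complex set" where
  "mandelbrot K \<theta> = {c. 0 \<notin> escaping_set (stretch_quad K \<theta> c)}"

end

theory Submission
  imports Defs
begin

text \<open>
  The affine stretch multiplies moduli by at least \<open>L = min K 1\<close>, so
  \<open>f\<^sub>c\<close> satisfies \<open>|f\<^sub>c(w)| \<ge> L\<^sup>2|w|\<^sup>2 - |c|\<close>. Once \<open>|w| \<ge> |c|\<close>, the right-hand side is at least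
  \<open>(L\<^sup>2|w| - 1)|w|\<close>, and the factor exceeds 1 exactly when \<open>|w| > 2 / L\<^sup>2\<close>. Hence a point that
  lies outside the disc of radius \<open>2 / L\<^sup>2\<close> and is no smaller in modulus than \<open>c\<close> has an orbit that grows
  geometrically (\<open>escapes_if_large\<close>).

  The critical value \<open>f\<^sub>c(0) = c\<close> always satisfies \<open>|c| \<ge> |c|\<close>, so \<open>|c| > 2 / L\<^sup>2\<close> makes the critical
  orbit escape. If \<open>|c| \<le> 2 / L\<^sup>2\<close>, then any orbit point outside the disc is automatically larger
  in modulus than \<open>c\<close>, so again the orbit escapes. Thus the critical orbit either stays in the disc
  for ever or escapes (\<open>mandelbrot_eq_orbit_bound\<close>). Compactness follows: each orbit point is a
  continuous function of \<open>c\<close>, so the bounds on the orbit cut out a closed set, and the bound on the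
  first orbit point \<open>c\<close> makes it bounded.
\<close>

text \<open>The two terms of the stretch have moduli \<open>(K+1)/2 |z|\<close> and \<open>|K-1|/2 |z|\<close>; their difference
  is \<open>min K 1 * |z|\<close>.\<close>

lemma norm_stretch_ge:
  assumes "K > 0"
  shows "min K 1 * cmod z \<le> cmod (stretch K \<theta> z)"
proof -
  define A where "A = of_real ((K + 1) / 2) * z"
  define B where "B = exp (2 * \<i> * of_real \<theta>) * of_real ((K - 1) / 2) * cnj z"
  have "cmod (exp (2 * \<i> * of_real \<theta>)) = 1"
    by (simp add: norm_exp_eq_Re)
  then have B: "cmod B = \<bar>(K - 1) / 2\<bar> * cmod z"
    unfolding B_def by (simp only: norm_mult norm_of_real complex_mod_cnj mult_1)
  have A: "cmod A = (K + 1) / 2 * cmod z"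
    unfolding A_def using assms by (simp only: norm_mult norm_of_real) simp
  have "min K 1 = (K + 1) / 2 - \<bar>(K - 1) / 2\<bar>"
    by (auto simp: min_def abs_if field_simps)
  then have "min K 1 * cmod z = cmod A - cmod B"
    by (simp only: A B left_diff_distrib)
  also have "\<dots> \<le> cmod (A + B)"
    by (rule norm_diff_ineq)
  finally show ?thesis
    by (simp add: stretch_def A_def B_def)
qed

lemma norm_stretch_quad_ge:
  assumes "K > 0"
  shows "(min K 1)\<^sup>2 * (cmod z)\<^sup>2 - cmod c \<le> cmod (stretch_quad K \<theta> c z)"
proof -
  have "(min K 1)\<^sup>2 * (cmod z)\<^sup>2 \<le> (cmod (stretch K \<theta> z))\<^sup>2"
    using power_mono[OF norm_stretch_ge[OF assms], of z 2 \<theta>] assms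
    by (simp add: power_mult_distrib)
  moreover have "cmod ((stretch K \<theta> z)\<^sup>2) - cmod c \<le> cmod ((stretch K \<theta> z)\<^sup>2 + c)"
    by (rule norm_diff_ineq)
  ultimately show ?thesis
    by (simp add: stretch_quad_def quad_map_def norm_power)
qed

text \<open>The growth factor is fixed at the starting point \<open>z\<close>: since the orbit never drops below
  \<open>|z|\<close> in modulus, the factor available later is at least as large.\<close>

lemma norm_orbit_ge:
  fixes K \<theta> :: real and c z :: complex
  defines "q \<equiv> (min K 1)\<^sup>2 * cmod z - 1"
  assumes "K > 0" "cmod c \<le> cmod z" "1 \<le> q"
  shows "q ^ n * cmod z \<le> cmod ((stretch_quad K \<theta> c ^^ n) z)"
proof (induction n)
  case 0
  show ?case by simp
next
  case (Suc n)
  define w where "w = (stretch_quad K \<theta> c ^^ n) z"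
  have IH: "q ^ n * cmod z \<le> cmod w"
    using Suc.IH by (simp add: w_def)
  have "1 \<le> q ^ n"
    using assms(4) by (rule one_le_power)
  then have zw: "cmod z \<le> cmod w"
    using IH mult_right_mono[of 1 "q ^ n" "cmod z"] by simp
  have "q ^ Suc n * cmod z \<le> q * cmod w"
    using IH assms(4) by (simp add: mult.assoc mult_left_mono)
  also have "\<dots> \<le> ((min K 1)\<^sup>2 * cmod w - 1) * cmod w"
    unfolding q_def using zw by (intro mult_right_mono diff_right_mono mult_left_mono) auto
  also have "\<dots> \<le> (min K 1)\<^sup>2 * (cmod w)\<^sup>2 - cmod c"
    using zw assms(3) by (simp add: algebra_simps power2_eq_square)
  also have "\<dots> \<le> cmod (stretch_quad K \<theta> c w)"
    using assms(2) by (rule norm_stretch_quad_ge)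
  finally show ?case
    by (simp add: w_def)
qed

lemma escapes_if_large:
  assumes "K > 0" "cmod c \<le> cmod z" "2 / (min K 1)\<^sup>2 < cmod z"
  shows "z \<in> escaping_set (stretch_quad K \<theta> c)"
proof -
  define q where "q = (min K 1)\<^sup>2 * cmod z - 1"
  have q: "1 < q"
    using assms(1,3) by (simp add: q_def field_simps)
  have "0 < cmod z"
    by (rule le_less_trans[OF _ assms(3)]) simp
  moreover have "filterlim (\<lambda>n. q ^ n) at_top sequentially"
    using filterlim_realpow_sequentially_gt1[of q] q
    by (simp add: filterlim_at_infinity_conv_norm_at_top norm_power)
  ultimately have "filterlim (\<lambda>n. q ^ n * cmod z) at_top sequentially"
    by (rule filterlim_at_top_mult_tendsto_pos[OF tendsto_const])
  then have "filterlim (\<lambda>n. cmod ((stretch_quad K \<theta> c ^^ n) z)) at_top sequentially"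
    by (rule filterlim_at_top_mono)
       (use norm_orbit_ge[OF assms(1,2)] q in \<open>simp add: q_def\<close>)
  then show ?thesis
    by (simp add: escaping_set_def filterlim_at_infinity_conv_norm_at_top)
qed

text \<open>Escape depends only on the tail of an orbit.\<close>

lemma escaping_set_funpow:
  assumes "(f ^^ m) z \<in> escaping_set f"
  shows "z \<in> escaping_set f"
  using assms
proof (induction m)
  case 0
  then show ?case by simp
next
  case (Suc m)
  define w where "w = (f ^^ m) z"
  have "filterlim (\<lambda>n. (f ^^ Suc n) w) at_infinity sequentially"
    using Suc.prems by (simp add: escaping_set_def w_def funpow_swap1)
  then have "filterlim (\<lambda>n. (f ^^ n) w) at_infinity sequentially"
    by (subst (asm) filterlim_sequentially_Suc)
  then show ?case
    by (intro Suc.IH) (simp add: escaping_set_def w_def)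
qed

lemma bounded_orbit_not_escaping:
  assumes "\<And>n. cmod ((f ^^ n) z) \<le> R"
  shows "z \<notin> escaping_set f"
proof
  assume "z \<in> escaping_set f"
  then have "filterlim (\<lambda>n. cmod ((f ^^ n) z)) at_top sequentially"
    by (simp add: escaping_set_def filterlim_at_infinity_conv_norm_at_top)
  then have "eventually (\<lambda>n. R < cmod ((f ^^ n) z)) sequentially"
    by (simp add: filterlim_at_top_dense)
  then show False
    using assms by (auto simp: eventually_sequentially not_less[symmetric])
qed

lemma stretch_quad_0: "stretch_quad K \<theta> c 0 = c"
  by (simp add: stretch_quad_def quad_map_def stretch_def)

lemma mandelbrot_norm_le:
  assumes "K > 0" "c \<in> mandelbrot K \<theta>"
  shows "cmod c \<le> 2 / (min K 1)\<^sup>2"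
proof (rule ccontr)
  assume "\<not> ?thesis"
  then have "c \<in> escaping_set (stretch_quad K \<theta> c)"
    using assms(1) by (intro escapes_if_large) auto
  then have "0 \<in> escaping_set (stretch_quad K \<theta> c)"
    using escaping_set_funpow[where m = 1 and z = 0] by (simp add: stretch_quad_0)
  then show False
    using assms(2) by (simp add: mandelbrot_def)
qed

lemma mandelbrot_eq_orbit_bound:
  assumes "K > 0"
  shows "mandelbrot K \<theta> =
    {c. \<forall>n. cmod ((stretch_quad K \<theta> c ^^ n) 0) \<le> 2 / (min K 1)\<^sup>2}"
proof (intro equalityI subsetI CollectI allI)
  fix c n
  assume c: "c \<in> mandelbrot K \<theta>"
  show "cmod ((stretch_quad K \<theta> c ^^ n) 0) \<le> 2 / (min K 1)\<^sup>2"
  proof (rule ccontr)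
    assume "\<not> ?thesis"
    then have "(stretch_quad K \<theta> c ^^ n) 0 \<in> escaping_set (stretch_quad K \<theta> c)"
      using assms mandelbrot_norm_le[OF assms c] by (intro escapes_if_large) auto
    then show False
      using c escaping_set_funpow by (auto simp: mandelbrot_def)
  qed
next
  fix c
  assume "c \<in> {c. \<forall>n. cmod ((stretch_quad K \<theta> c ^^ n) 0) \<le> 2 / (min K 1)\<^sup>2}"
  then show "c \<in> mandelbrot K \<theta>"
    unfolding mandelbrot_def using bounded_orbit_not_escaping by blast
qed

lemma continuous_on_stretch_quad:
  assumes "continuous_on S g"
  shows "continuous_on S (\<lambda>c. stretch_quad K \<theta> c (g c))"
  unfolding stretch_quad_def quad_map_def stretch_def comp_apply
  by (intro continuous_on_add continuous_on_power continuous_on_mult continuous_on_const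
      continuous_on_cnj continuous_on_id assms)

lemma continuous_on_orbit_parameter:
  "continuous_on S (\<lambda>c. (stretch_quad K \<theta> c ^^ n) z)"
proof (induction n)
  case 0
  show ?case by simp
next
  case (Suc n)
  show ?case
    unfolding funpow.simps comp_apply by (rule continuous_on_stretch_quad[OF Suc.IH])
qed

lemma compact_mandelbrot:
  assumes "K > 0"
  shows "compact (mandelbrot K \<theta>)"
proof -
  have "closed {c. \<forall>n. cmod ((stretch_quad K \<theta> c ^^ n) 0) \<le> 2 / (min K 1)\<^sup>2}"
    by (intro closed_Collect_all closed_Collect_le continuous_intros continuous_on_orbit_parameter)
  then have "closed (mandelbrot K \<theta>)"
    by (simp only: mandelbrot_eq_orbit_bound[OF assms])
  moreover have "bounded (mandelbrot K \<theta>)"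
    using mandelbrot_norm_le[OF assms] by (auto simp: bounded_iff)
  ultimately show ?thesis
    by (simp add: compact_eq_bounded_closed)
qed

theorem theorem6p3:
  fixes K \<theta> L1 :: real
  assumes "K > 0"
    and "- pi / 4 < \<theta>" and "\<theta> \<le> pi / 4"
    and "of_real K * exp (\<i> * of_real \<theta>) \<in> param_region"
    and "L1 = min K 1"
  shows "mandelbrot K \<theta> \<subseteq> {c. cmod c \<le> 2 / L1\<^sup>2}
    \<and> compact (mandelbrot K \<theta>)
    \<and> mandelbrot K \<theta> =
        {c. \<forall>n::nat. cmod ((stretch_quad K \<theta> c ^^ n) 0) \<le> 2 / L1\<^sup>2}"
  unfolding assms(5)
proof (intro conjI subsetI CollectI)
  show "cmod c \<le> 2 / (min K 1)\<^sup>2" if "c \<in> mandelbrot K \<theta>" for c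
    using assms(1) that by (rule mandelbrot_norm_le)
qed (rule compact_mandelbrot[OF assms(1)] mandelbrot_eq_orbit_bound[OF assms(1)])+

end
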